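(* Let $R$ be an exchange ring which is a $C\Delta$ ring. Then $R$ is clean.
   Context: All rings are associative with identity, not necessarily commutative. $U(R)$ is the group of units of $R$ and $C(R)$ its set of central elements. $\Delta(R)=\{a\in R : 1-ua\in U(R)\text{ for all }u\in U(R)\}$. A ring $R$ is called $C\Delta$ if every $a\in R$ can be written as $a=c+r$ with $c\in C(R)$ and $r\in\Delta(R)$. A ring $R$ is exchange if for each $a\in R$ there exists $e=e^2\in aR$ such that $1-e\in(1-a)R$. A ring is clean if every element is the sum of an idempotent and a unit. *)

theory Defs
  imports "HOL-Algebra.Ring"
begin

text \<open>
  Rings are those of the locale \<open>ring\<close>: associative and unital, not necessarily commutative,
  with the zero ring allowed. \<open>Units R\<close> consists of the two-sided units.
  The predicates below are meant for structures \<open>R\<close> with \<open>ring R\<close>.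
\<close>

definition ring_center :: "('a, 'm) ring_scheme \<Rightarrow> 'a set" where
  "ring_center R = {c \<in> carrier R. \<forall>x \<in> carrier R. c \<otimes>\<^bsub>R\<^esub> x = x \<otimes>\<^bsub>R\<^esub> c}"

definition ring_Delta :: "('a, 'm) ring_scheme \<Rightarrow> 'a set" where
  "ring_Delta R = {a \<in> carrier R. \<forall>u \<in> Units R. \<one>\<^bsub>R\<^esub> \<ominus>\<^bsub>R\<^esub> u \<otimes>\<^bsub>R\<^esub> a \<in> Units R}"

definition ring_idempotents :: "('a, 'm) ring_scheme \<Rightarrow> 'a set" where
  "ring_idempotents R = {e \<in> carrier R. e \<otimes>\<^bsub>R\<^esub> e = e}"

definition principal_right_ideal :: "('a, 'm) ring_scheme \<Rightarrow> 'a \<Rightarrow> 'a set" where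
  "principal_right_ideal R a = {a \<otimes>\<^bsub>R\<^esub> x | x. x \<in> carrier R}"

definition CDelta_ring :: "('a, 'm) ring_scheme \<Rightarrow> bool" where
  "CDelta_ring R \<longleftrightarrow>
     (\<forall>a \<in> carrier R. \<exists>c \<in> ring_center R. \<exists>r \<in> ring_Delta R. a = c \<oplus>\<^bsub>R\<^esub> r)"

definition exchange_ring :: "('a, 'm) ring_scheme \<Rightarrow> bool" where
  "exchange_ring R \<longleftrightarrow>
     (\<forall>a \<in> carrier R. \<exists>e \<in> ring_idempotents R.
        e \<in> principal_right_ideal R a \<and>
        \<one>\<^bsub>R\<^esub> \<ominus>\<^bsub>R\<^esub> e \<in> principal_right_ideal R (\<one>\<^bsub>R\<^esub> \<ominus>\<^bsub>R\<^esub> a))"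

definition clean_ring :: "('a, 'm) ring_scheme \<Rightarrow> bool" where
  "clean_ring R \<longleftrightarrow>
     (\<forall>a \<in> carrier R. \<exists>e \<in> ring_idempotents R. \<exists>u \<in> Units R. a = e \<oplus>\<^bsub>R\<^esub> u)"

end

theory Submission
  imports Defs
begin

text \<open>
  \<open>\<Delta>(R)\<close> is closed under sums, products and multiplication by units. If \<open>e = c + r\<close> is
  idempotent with \<open>c\<close> central and \<open>r \<in> \<Delta>(R)\<close>, and \<open>n = en\<close>, \<open>ne = 0\<close>, then conjugating by
  \<open>1 + n\<close> gives \<open>e - n = c + (1 + n) r (1 - n)\<close>, so \<open>n \<in> \<Delta>(R)\<close>: the off-diagonal Peirce
  components of \<open>R\<close> lie in \<open>\<Delta>(R)\<close>, although they need not vanish. If \<open>ab = 1\<close> and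
  \<open>h = 1 - ba\<close>, then \<open>ha\<close> and \<open>bh\<close> are such components with product \<open>h\<close>, so the idempotent
  \<open>h\<close> lies in \<open>\<Delta>(R)\<close> and is \<open>0\<close>; hence \<open>R\<close> is Dedekind finite.
  Finally let \<open>e = ax\<close> and \<open>1 - e = (1 - a)y\<close> with \<open>x = xe\<close> and \<open>y = y(1 - e)\<close>. Then
  \<open>(a - (1 - e))(x - y) = 1 - (1 - e)xe - ey(1 - e)\<close> is a unit, so \<open>a - (1 - e)\<close> is a unit.
\<close>

context ring
begin

section \<open>Elementary identities for differences, units and idempotents\<close>

lemma add_minus_cancel_left:
  assumes "x \<in> carrier R" "y \<in> carrier R"
  shows "x \<oplus> (y \<ominus> x) = y"
  using assms by (metis a_comm a_minus_def add.inv_solve_right minus_closed)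

lemma minus_minus_cancel_left:
  assumes "x \<in> carrier R" "y \<in> carrier R"
  shows "x \<ominus> (x \<ominus> y) = y"
  using assms by (simp add: minus_eq minus_add a_assoc[symmetric] r_neg)

lemma minus_distrib_left:
  assumes "x \<in> carrier R" "y \<in> carrier R" "z \<in> carrier R"
  shows "x \<otimes> (y \<ominus> z) = x \<otimes> y \<ominus> x \<otimes> z"
  using assms by (simp add: minus_eq r_distr r_minus)

lemma minus_distrib_right:
  assumes "x \<in> carrier R" "y \<in> carrier R" "z \<in> carrier R"
  shows "(y \<ominus> z) \<otimes> x = y \<otimes> x \<ominus> z \<otimes> x"
  using assms by (simp add: minus_eq l_distr l_minus)

lemma Units_uminus:
  assumes "u \<in> Units R"
  shows "\<ominus> u \<in> Units R"
proof -
  have [simp]: "u \<in> carrier R" "inv u \<in> carrier R" using assms by auto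
  have "(\<ominus> (inv u)) \<otimes> (\<ominus> u) = \<one>" "(\<ominus> u) \<otimes> (\<ominus> (inv u)) = \<one>"
    using assms by (simp_all add: l_minus r_minus)
  then show ?thesis unfolding Units_def by (auto intro!: bexI[of _ "\<ominus> (inv u)"])
qed

lemma idempotent_one_minus:
  assumes "e \<in> ring_idempotents R"
  shows "\<one> \<ominus> e \<in> ring_idempotents R"
proof -
  have [simp]: "e \<in> carrier R" "e \<otimes> e = e" using assms by (auto simp: ring_idempotents_def)
  show ?thesis
    by (simp add: ring_idempotents_def minus_distrib_left minus_distrib_right)
      (simp add: minus_eq r_neg)
qed

section \<open>Closure properties of \<open>ring_Delta R\<close>\<close>

lemma Delta_carrier: "r \<in> ring_Delta R \<Longrightarrow> r \<in> carrier R"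
  by (simp add: ring_Delta_def)

lemma one_minus_Delta_Units:
  assumes "r \<in> ring_Delta R"
  shows "\<one> \<ominus> r \<in> Units R"
proof -
  have "\<one> \<ominus> \<one> \<otimes> r \<in> Units R" using assms unfolding ring_Delta_def by blast
  then show ?thesis using assms by (simp add: Delta_carrier)
qed

text \<open>Factor out the unit v = 1 - ur: then 1 - u(r + s) = v(1 - (v^-1 u)s), a product of two
  units.\<close>

lemma Delta_add:
  assumes "r \<in> ring_Delta R" "s \<in> ring_Delta R"
  shows "r \<oplus> s \<in> ring_Delta R"
proof -
  have [simp]: "r \<in> carrier R" "s \<in> carrier R" using assms by (auto simp: Delta_carrier)
  have "\<one> \<ominus> u \<otimes> (r \<oplus> s) \<in> Units R" if u: "u \<in> Units R" for u
  proof -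
    have [simp]: "u \<in> carrier R" using u by auto
    define v where "v = \<one> \<ominus> u \<otimes> r"
    have v: "v \<in> Units R" using assms u by (simp add: v_def ring_Delta_def)
    then have [simp]: "v \<in> carrier R" by auto
    have "\<one> \<ominus> (inv v \<otimes> u) \<otimes> s \<in> Units R"
      using assms u v by (simp add: ring_Delta_def)
    then have "v \<otimes> (\<one> \<ominus> (inv v \<otimes> u) \<otimes> s) \<in> Units R" using v by simp
    also have "v \<otimes> (\<one> \<ominus> (inv v \<otimes> u) \<otimes> s) = v \<ominus> u \<otimes> s"
      using v by (simp add: minus_distrib_left m_assoc[symmetric])
    also have "\<dots> = \<one> \<ominus> u \<otimes> (r \<oplus> s)"
      by (simp add: v_def minus_eq r_distr minus_add a_assoc)
    finally show ?thesis .
  qed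
  then show ?thesis by (simp add: ring_Delta_def)
qed

lemma Delta_uminus:
  assumes "r \<in> ring_Delta R"
  shows "\<ominus> r \<in> ring_Delta R"
proof -
  have [simp]: "r \<in> carrier R" using assms by (rule Delta_carrier)
  have "\<one> \<ominus> u \<otimes> (\<ominus> r) \<in> Units R" if u: "u \<in> Units R" for u
  proof -
    have "\<one> \<ominus> (\<ominus> u) \<otimes> r \<in> Units R"
      using assms Units_uminus[OF u] by (simp add: ring_Delta_def)
    then show ?thesis using u by (simp add: l_minus r_minus Units_closed)
  qed
  then show ?thesis by (simp add: ring_Delta_def)
qed

lemma Delta_minus:
  assumes "r \<in> ring_Delta R" "s \<in> ring_Delta R"
  shows "r \<ominus> s \<in> ring_Delta R"
  using assms by (simp add: minus_eq Delta_add Delta_uminus)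

lemma Delta_Units_mult_left:
  assumes "v \<in> Units R" "r \<in> ring_Delta R"
  shows "v \<otimes> r \<in> ring_Delta R"
proof -
  have [simp]: "v \<in> carrier R" "r \<in> carrier R" using assms by (auto simp: Delta_carrier)
  have "\<one> \<ominus> u \<otimes> (v \<otimes> r) \<in> Units R" if u: "u \<in> Units R" for u
  proof -
    have "\<one> \<ominus> (u \<otimes> v) \<otimes> r \<in> Units R" using assms u by (simp add: ring_Delta_def)
    then show ?thesis using u by (simp add: m_assoc Units_closed)
  qed
  then show ?thesis by (simp add: ring_Delta_def)
qed

text \<open>The definition has units on the left only; conjugation moves v across, since 1 - u(rv) =
  v^-1 (1 - (vu)r) v.\<close>

lemma Delta_Units_mult_right:
  assumes v: "v \<in> Units R" and r: "r \<in> ring_Delta R"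
  shows "r \<otimes> v \<in> ring_Delta R"
proof -
  have [simp]: "r \<in> carrier R" "v \<in> carrier R" "inv v \<in> carrier R"
    using assms by (auto simp: Delta_carrier)
  have "\<one> \<ominus> u \<otimes> (r \<otimes> v) \<in> Units R" if u: "u \<in> Units R" for u
  proof -
    have [simp]: "u \<in> carrier R" using u by auto
    have "inv v \<otimes> (\<one> \<ominus> (v \<otimes> u) \<otimes> r) \<otimes> v \<in> Units R"
      using u v r by (simp add: ring_Delta_def)
    also have "inv v \<otimes> (\<one> \<ominus> (v \<otimes> u) \<otimes> r) = inv v \<ominus> u \<otimes> r"
      using v by (simp add: minus_distrib_left m_assoc[symmetric])
    also have "(inv v \<ominus> u \<otimes> r) \<otimes> v = \<one> \<ominus> u \<otimes> (r \<otimes> v)"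
      using v by (simp add: minus_distrib_right m_assoc)
    finally show ?thesis .
  qed
  then show ?thesis by (simp add: ring_Delta_def)
qed

text \<open>Since 1 - s is a unit, rs = r - r(1 - s) is a difference of two elements already known
  to lie in \<open>ring_Delta R\<close>.\<close>

lemma Delta_mult:
  assumes "r \<in> ring_Delta R" "s \<in> ring_Delta R"
  shows "r \<otimes> s \<in> ring_Delta R"
proof -
  have [simp]: "r \<in> carrier R" "s \<in> carrier R" using assms by (auto simp: Delta_carrier)
  have "r \<ominus> r \<otimes> (\<one> \<ominus> s) \<in> ring_Delta R"
    using assms by (intro Delta_minus Delta_Units_mult_right one_minus_Delta_Units)
  then show ?thesis by (simp add: minus_distrib_left minus_minus_cancel_left)
qed

text \<open>The unit 1 - e annihilates e, so it can be cancelled from e(1 - e) = 0.\<close>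

lemma idempotent_Delta_eq_zero:
  assumes "e \<in> ring_idempotents R" "e \<in> ring_Delta R"
  shows "e = \<zero>"
proof -
  have [simp]: "e \<in> carrier R" using assms by (simp add: Delta_carrier)
  have u: "\<one> \<ominus> e \<in> Units R" using assms(2) by (rule one_minus_Delta_Units)
  have "e \<otimes> (\<one> \<ominus> e) = \<zero>"
    using assms(1) by (simp add: ring_idempotents_def minus_distrib_left) (simp add: minus_eq r_neg)
  then have "e \<otimes> ((\<one> \<ominus> e) \<otimes> inv (\<one> \<ominus> e)) = \<zero>"
    using u by (simp add: m_assoc[symmetric] del: Units_r_inv)
  then show ?thesis using u by simp
qed

section \<open>Off-diagonal Peirce components and Dedekind finiteness\<close>

lemma CDelta_off_diagonal:
  assumes "CDelta_ring R" "e \<in> ring_idempotents R"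
    and n: "n \<in> carrier R" "e \<otimes> n = n" "n \<otimes> e = \<zero>"
  shows "n \<in> ring_Delta R"
proof -
  have [simp]: "e \<in> carrier R" "e \<otimes> e = e"
    using assms by (auto simp: ring_idempotents_def)
  note n [simp]
  obtain c r where c: "c \<in> ring_center R" and r: "r \<in> ring_Delta R" and e: "e = c \<oplus> r"
    using assms(1) unfolding CDelta_ring_def by (meson \<open>e \<in> carrier R\<close>)
  have [simp]: "c \<in> carrier R" "r \<in> carrier R"
    using c r by (auto simp: ring_center_def Delta_carrier)
  \<comment> \<open>n^2 = n(en) = (ne)n = 0, which makes 1 + n and 1 - n mutually inverse.\<close>
  have [simp]: "n \<otimes> n = \<zero>"
    by (metis n m_assoc \<open>e \<in> carrier R\<close> l_null)
  define v w where "v = \<one> \<oplus> n" and "w = \<one> \<ominus> n"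
  have [simp]: "v \<in> carrier R" "w \<in> carrier R" by (simp_all add: v_def w_def)
  have vw: "v \<otimes> w = \<one>" "w \<otimes> v = \<one>"
    by (simp_all add: v_def w_def minus_eq l_distr r_distr l_minus r_minus a_assoc l_neg r_neg)
  then have U: "v \<in> Units R" "w \<in> Units R" by (auto simp: Units_def)
  have "v \<otimes> e \<otimes> w = e \<ominus> n"
    by (simp add: v_def w_def l_distr r_distr minus_eq r_minus)
  moreover have "v \<otimes> e \<otimes> w = v \<otimes> c \<otimes> w \<oplus> v \<otimes> r \<otimes> w"
    by (simp add: e l_distr r_distr)
  moreover have "v \<otimes> c \<otimes> w = c"
  proof -
    have "v \<otimes> c = c \<otimes> v" using c by (simp add: ring_center_def)
    then show ?thesis using vw by (simp add: m_assoc)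
  qed
  ultimately have "e \<ominus> n = c \<oplus> v \<otimes> r \<otimes> w" by simp
  \<comment> \<open>Conjugation fixes the central part, so c cancels between e = c + r and its
    conjugate; n is left as r - vrw.\<close>
  then have "n = e \<ominus> (c \<oplus> v \<otimes> r \<otimes> w)"
    by (metis minus_minus_cancel_left n(1) \<open>e \<in> carrier R\<close>)
  also have "\<dots> = c \<oplus> (\<ominus> c \<oplus> (r \<ominus> v \<otimes> r \<otimes> w))"
    by (simp add: e minus_eq minus_add a_ac)
  also have "\<dots> = r \<ominus> v \<otimes> r \<otimes> w" by (simp add: r_neg2)
  finally show ?thesis
    using r U by (simp add: Delta_minus Delta_Units_mult_left Delta_Units_mult_right)
qed

lemma CDelta_Dedekind_finite:
  assumes C: "CDelta_ring R" and [simp]: "a \<in> carrier R" "b \<in> carrier R"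
    and ab: "a \<otimes> b = \<one>"
  shows "a \<in> Units R"
proof -
  define h where "h = \<one> \<ominus> b \<otimes> a"
  have [simp]: "h \<in> carrier R" by (simp add: h_def)
  have "a \<otimes> h = a \<ominus> (a \<otimes> b) \<otimes> a"
    by (simp add: h_def minus_distrib_left m_assoc)
  then have ah [simp]: "a \<otimes> h = \<zero>" using ab by (simp add: minus_eq r_neg)
  have "h \<otimes> b = b \<ominus> b \<otimes> (a \<otimes> b)"
    by (simp add: h_def minus_distrib_right m_assoc)
  then have hb [simp]: "h \<otimes> b = \<zero>" using ab by (simp add: minus_eq r_neg)
  have "h \<otimes> h = h \<ominus> (h \<otimes> b) \<otimes> a"
    by (subst (2) h_def) (simp add: minus_distrib_left m_assoc del: hb)
  then have hh [simp]: "h \<otimes> h = h" by (simp add: minus_eq)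
  have h: "h \<in> ring_idempotents R" by (simp add: ring_idempotents_def)
  have "h \<otimes> a \<in> ring_Delta R"
    by (rule CDelta_off_diagonal[OF C h]) (simp_all add: m_assoc[symmetric], simp add: m_assoc)
  \<comment> \<open>This component lies in the opposite corner from ha, hence the use of the
    complementary idempotent 1 - h.\<close>
  moreover have "b \<otimes> h \<in> ring_Delta R"
  proof (rule CDelta_off_diagonal[OF C idempotent_one_minus[OF h]])
    have "h \<otimes> (b \<otimes> h) = \<zero>" by (simp add: m_assoc[symmetric])
    then show "(\<one> \<ominus> h) \<otimes> (b \<otimes> h) = b \<otimes> h"
      by (simp add: minus_distrib_right) (simp add: minus_eq)
    show "b \<otimes> h \<otimes> (\<one> \<ominus> h) = \<zero>"
      by (simp add: minus_distrib_left m_assoc) (simp add: minus_eq r_neg)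
  qed simp
  ultimately have "h \<otimes> a \<otimes> (b \<otimes> h) \<in> ring_Delta R" by (rule Delta_mult)
  \<comment> \<open>With ab = 1 the right-hand side collapses to hh = h.\<close>
  moreover have "h \<otimes> a \<otimes> (b \<otimes> h) = h \<otimes> (a \<otimes> b) \<otimes> h" by (simp add: m_assoc)
  ultimately have "h \<in> ring_Delta R" using ab by simp
  then have "h = \<zero>" using h by (simp add: idempotent_Delta_eq_zero)
  then have "b \<otimes> a = \<one>"
    using minus_minus_cancel_left[of \<one> "b \<otimes> a"] by (simp add: h_def[symmetric]) (simp add: minus_eq)
  then show ?thesis using ab by (auto simp: Units_def)
qed

section \<open>From the exchange property to a clean decomposition\<close>

lemma exchange_identity:
  assumes [simp]: "a \<in> carrier R" "x \<in> carrier R" "y \<in> carrier R" "e \<in> carrier R"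
    and ax: "a \<otimes> x = e" and ay: "(\<one> \<ominus> a) \<otimes> y = \<one> \<ominus> e"
  shows "(a \<ominus> (\<one> \<ominus> e)) \<otimes> (x \<ominus> y) = \<one> \<ominus> ((\<one> \<ominus> e) \<otimes> x \<oplus> e \<otimes> y)"
proof -
  have "y \<ominus> a \<otimes> y = \<one> \<ominus> e" using ay by (simp add: minus_distrib_right)
  \<comment> \<open>Substituting this and ax = e into the expanded product makes y and e cancel,
    leaving 1 minus the two mixed terms.\<close>
  then have "a \<otimes> y = y \<ominus> (\<one> \<ominus> e)"
    by (metis minus_minus_cancel_left assms(1,3) m_closed)
  moreover have "(a \<ominus> (\<one> \<ominus> e)) \<otimes> (x \<ominus> y)
      = a \<otimes> x \<ominus> a \<otimes> y \<ominus> ((\<one> \<ominus> e) \<otimes> x \<ominus> (y \<ominus> e \<otimes> y))"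
    by (simp add: minus_distrib_left minus_distrib_right minus_eq minus_add l_distr r_distr
        l_minus r_minus a_ac)
  ultimately show ?thesis
    by (simp add: ax minus_eq minus_add l_distr r_distr l_minus r_minus a_ac r_neg1 r_neg2 l_neg r_neg)
qed

lemma exchange_CDelta_clean:
  assumes E: "exchange_ring R" and C: "CDelta_ring R"
  shows "clean_ring R"
  unfolding clean_ring_def
proof
  fix a assume [simp]: "a \<in> carrier R"
  obtain e x\<^sub>0 y\<^sub>0 where e: "e \<in> ring_idempotents R"
    and [simp]: "x\<^sub>0 \<in> carrier R" "y\<^sub>0 \<in> carrier R"
    and x0: "e = a \<otimes> x\<^sub>0" and y0: "\<one> \<ominus> e = (\<one> \<ominus> a) \<otimes> y\<^sub>0"
    using E unfolding exchange_ring_def principal_right_ideal_def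
    by (smt (verit) \<open>a \<in> carrier R\<close> mem_Collect_eq)
  define f where "f = \<one> \<ominus> e"
  have f: "f \<in> ring_idempotents R" using e by (simp add: f_def idempotent_one_minus)
  have [simp]: "e \<in> carrier R" "f \<in> carrier R" and ee [simp]: "e \<otimes> e = e" "f \<otimes> f = f"
    using e f by (auto simp: ring_idempotents_def)
  have ef [simp]: "e \<otimes> f = \<zero>" "f \<otimes> e = \<zero>"
    by (simp_all add: f_def minus_distrib_left minus_distrib_right) (simp_all add: minus_eq r_neg)
  \<comment> \<open>As e and f are idempotent, this normalization preserves both exchange equations;
    it also gives fx = fxe and ey = eyf, which are off-diagonal.\<close>
  define x y where "x = x\<^sub>0 \<otimes> e" and "y = y\<^sub>0 \<otimes> f"
  have [simp]: "x \<in> carrier R" "y \<in> carrier R" by (simp_all add: x_def y_def)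
  have "a \<otimes> x = (a \<otimes> x\<^sub>0) \<otimes> e" by (simp add: x_def m_assoc)
  then have ax: "a \<otimes> x = e" by (simp add: x0[symmetric])
  have "(\<one> \<ominus> a) \<otimes> y = ((\<one> \<ominus> a) \<otimes> y\<^sub>0) \<otimes> f" by (simp add: y_def m_assoc)
  then have ay: "(\<one> \<ominus> a) \<otimes> y = \<one> \<ominus> e" by (simp add: y0[symmetric]) (simp add: f_def[symmetric])
  have "f \<otimes> x \<in> ring_Delta R"
    by (rule CDelta_off_diagonal[OF C f])
      (simp_all add: m_assoc[symmetric], simp add: x_def m_assoc)
  moreover have "e \<otimes> y \<in> ring_Delta R"
    by (rule CDelta_off_diagonal[OF C e])
      (simp_all add: m_assoc[symmetric], simp add: y_def m_assoc)
  ultimately have "\<one> \<ominus> (f \<otimes> x \<oplus> e \<otimes> y) \<in> Units R"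
    by (intro one_minus_Delta_Units Delta_add)
  moreover define u where "u = a \<ominus> f"
  ultimately have w: "u \<otimes> (x \<ominus> y) \<in> Units R"
    using exchange_identity[OF _ _ _ _ ax ay] by (simp add: f_def)
  have [simp]: "u \<in> carrier R" by (simp add: u_def)
  \<comment> \<open>A unit product gives its left factor u only a right inverse; Dedekind finiteness
    makes it two-sided.\<close>
  have "u \<otimes> ((x \<ominus> y) \<otimes> inv (u \<otimes> (x \<ominus> y))) = \<one>"
    using w by (simp add: m_assoc[symmetric])
  then have "u \<in> Units R"
    using w by (intro CDelta_Dedekind_finite[OF C, of u "(x \<ominus> y) \<otimes> inv (u \<otimes> (x \<ominus> y))"]) auto
  moreover have "a = f \<oplus> u" by (simp add: u_def add_minus_cancel_left)
  ultimately show "\<exists>e\<in>ring_idempotents R. \<exists>u\<in>Units R. a = e \<oplus> u"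
    using f by blast
qed

end

theorem corollary2p9:
  fixes R :: "('a, 'm) ring_scheme"
  assumes "ring R"
    and "exchange_ring R"
    and "CDelta_ring R"
  shows "clean_ring R"
  using assms by (rule ring.exchange_CDelta_clean)

end
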